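(* Let $D=(F,R,>)$ be a defeasible theory, let $\mathcal{M}$ be the logic program associated with $D$ (described in the context), and let $p$ be a literal. (a) If $D\vdash +\Delta p$, then the atom $\mathtt{definitely}(p)$ belongs to every stable model of $\mathcal{M}$. (b) If $D\vdash -\Delta p$, then $\mathtt{definitely}(p)$ belongs to no stable model of $\mathcal{M}$. (c) If $D$ is decisive, then the converses of (a) and (b) also hold: if $\mathtt{definitely}(p)$ belongs to every stable model of $\mathcal{M}$ then $D\vdash+\Delta p$, and if $\mathtt{definitely}(p)$ belongs to no stable model of $\mathcal{M}$ then $D\vdash-\Delta p$.
   Context: Literals are atoms $p$ or negated atoms $\neg p$; for a literal $q$, $\sim q$ is its complement ($\sim p=\neg p$, $\sim\neg p=p$). A defeasible theory $D=(F,R,>)$ consists of a finite set $F$ of literals (facts), a finite set $R$ of propositional rules, and a binary relation $>$ on $R$ whose transitive closure is irreflexive (superiority). Each rule $r$ has a unique label, an antecedent $A(r)$ (a finite set of literals), a head $C(r)$ (a literal), and a kind: strict ($A(r)\to C(r)$), defeasible ($A(r)\Rightarrow C(r)$) or defeater ($A(r)\leadsto C(r)$). $R_s$ is the set of strict rules, $R_{sd}$ the set of strict or defeasible rules, and $R[q]$ (resp. $R_s[q]$, $R_{sd}[q]$) those with head $q$. A derivation in $D$ is a finite sequence $P(1),\dots,P(n)$ of tagged literals $+\Delta q,-\Delta q,+\partial q,-\partial q$ such that for each $i$, writing $P(1..i)$ for the initial segment of length $i$: ($+\Delta$) if $P(i+1)=+\Delta q$ then $q\in F$ or $\exists r\in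 R_s[q]\,\forall a\in A(r):+\Delta a\in P(1..i)$; ($-\Delta$) if $P(i+1)=-\Delta q$ then $q\notin F$ and $\forall r\in R_s[q]\,\exists a\in A(r): -\Delta a\in P(1..i)$; ($+\partial$) if $P(i+1)=+\partial q$ then either (1) $+\Delta q\in P(1..i)$, or (2) $\exists r\in R_{sd}[q]\,\forall a\in A(r):+\partial a\in P(1..i)$, and $-\Delta\sim q\in P(1..i)$, and for every $s\in R[\sim q]$ either $\exists a\in A(s):-\partial a\in P(1..i)$, or $\exists t\in R_{sd}[q]$ with $t>s$ and $\forall a\in A(t):+\partial a\in P(1..i)$; ($-\partial$) if $P(i+1)=-\partial q$ then (1) $-\Delta q\in P(1..i)$ and (2) either $\forall r\in R_{sd}[q]\,\exists a\in A(r):-\partial a\in P(1..i)$, or $+\Delta\sim q\in P(1..i)$, or $\exists s\in R[\sim q]$ such that $\forall a\in A(s):+\partial a\in P(1..i)$ and for every $t\in R_{sd}[q]$ either $\exists a\in A(t):-\partial a\in P(1..i)$ or $t\not> s$. $D\vdash L$ means $L$ occurs in some derivation in $D$. The dependency graph of $D$ has as vertices the sets $\{q,\sim q\}$ for literals $q$ occurring in $D$, and an arc from $\{b,\sim b\}$ to $\{a,\sim a\}$ whenever some rule $r\in R[b]$ has $a\in A(r)$. $D$ is decisive iff this graph is acyclic. The program $\mathcal{M}$: constants are the literals and rule labels of $D$, with list terms $[x_1,\dots,x_n]$ ($n\ge0$) and $\sim$ read as the complement on literals. $\mathcal{M}$ consists of all ground instances (label variables $R,S,T$ over rule labels, $X,Y_i,U_i,V_i$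 over literals, $B$ over lists of literals, every $n\ge 0$) of the clauses $\mathtt{supportive\_rule}(R,X,B)\leftarrow\mathtt{strict}(R,X,B)$; $\mathtt{supportive\_rule}(R,X,B)\leftarrow\mathtt{defeasible}(R,X,B)$; $\mathtt{rule}(R,X,B)\leftarrow\mathtt{supportive\_rule}(R,X,B)$; $\mathtt{rule}(R,X,B)\leftarrow\mathtt{defeater}(R,X,B)$; $\mathtt{definitely}(X)\leftarrow\mathtt{fact}(X)$; $\mathtt{definitely}(X)\leftarrow\mathtt{strict}(R,X,[Y_1,\dots,Y_n]),\mathtt{definitely}(Y_1),\dots,\mathtt{definitely}(Y_n)$; $\mathtt{defeasibly}(X)\leftarrow\mathtt{definitely}(X)$; $\mathtt{defeasibly}(X)\leftarrow \mathit{not}\ \mathtt{definitely}(\sim X),\mathtt{supportive\_rule}(R,X,[Y_1,\dots,Y_n]),\mathtt{defeasibly}(Y_1),\dots,\mathtt{defeasibly}(Y_n),\mathit{not}\ \mathtt{overruled}(R,X)$; $\mathtt{overruled}(R,X)\leftarrow\mathtt{rule}(S,\sim X,[U_1,\dots,U_n]),\mathtt{defeasibly}(U_1),\dots,\mathtt{defeasibly}(U_n),\mathit{not}\ \mathtt{defeated}(S,\sim X)$; $\mathtt{defeated}(S,\sim X)\leftarrow\mathtt{sup}(T,S),\mathtt{supportive\_rule}(T,X,[V_1,\dots,V_n]),\mathtt{defeasibly}(V_1),\dots,\mathtt{defeasibly}(V_n)$; together with the facts $\mathtt{fact}(p)$ for $p\in F$; $\mathtt{strict}(r,p,[q_1,\dots,q_n])$,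 $\mathtt{defeasible}(r,p,[q_1,\dots,q_n])$, $\mathtt{defeater}(r,p,[q_1,\dots,q_n])$ for each strict, defeasible, resp. defeater rule $r:q_1,\dots,q_n\to p$ / $\Rightarrow p$ / $\leadsto p$ in $R$; and $\mathtt{sup}(r_i,r_j)$ whenever $r_i>r_j$. Stable models: for a set $M$ of ground atoms, the reduct $\mathcal{M}^M$ is obtained by deleting every ground clause having some $\mathit{not}\ C$ in its body with $C\in M$, and deleting all remaining $\mathit{not}$-literals from the other clauses; $M$ is a stable model iff $M$ equals the least Herbrand model of $\mathcal{M}^M$. *)

theory Defs
  imports Main
begin

section \<open>Defeasible theories\<close>

datatype 'a lit = Pos 'a | Neg 'a

fun complement :: "'a lit \<Rightarrow> 'a lit" where
  "complement (Pos a) = Neg a"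
| "complement (Neg a) = Pos a"

datatype kind = Strict_kind | Defeasible_kind | Defeater_kind

datatype ('a, 'l) drule =
  DRule (label: 'l) (kind: kind) (ant: "'a lit set") (head: "'a lit")

record ('a, 'l) dtheory =
  facts :: "'a lit set"
  rules :: "('a, 'l) drule set"
  superior :: "('a, 'l) drule rel"  \<comment> \<open>a pair \<open>(r, s)\<close> means \<open>r > s\<close>\<close>

definition defeasible_theory :: "('a, 'l) dtheory \<Rightarrow> bool" where
  "defeasible_theory D \<longleftrightarrow>
     finite (facts D) \<and>
     finite (rules D) \<and>
     inj_on label (rules D) \<and>
     (\<forall>r\<in>rules D. finite (ant r)) \<and>
     superior D \<subseteq> rules D \<times> rules D \<and>
     irrefl ((superior D)\<^sup>+)"

definition rules_for :: "('a, 'l) dtheory \<Rightarrow> 'a lit \<Rightarrow> ('a, 'l) drule set" where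
  "rules_for D q = {r \<in> rules D. head r = q}"

definition strict_for :: "('a, 'l) dtheory \<Rightarrow> 'a lit \<Rightarrow> ('a, 'l) drule set" where
  "strict_for D q = {r \<in> rules_for D q. kind r = Strict_kind}"

definition supportive_for :: "('a, 'l) dtheory \<Rightarrow> 'a lit \<Rightarrow> ('a, 'l) drule set" where
  "supportive_for D q = {r \<in> rules_for D q. kind r = Strict_kind \<or> kind r = Defeasible_kind}"


section \<open>Derivations\<close>

datatype 'a tagged =
    Plus_Delta "'a lit"
  | Minus_Delta "'a lit"
  | Plus_Partial "'a lit"
  | Minus_Partial "'a lit"

text \<open>
  \<open>derivable_next D S L\<close>: the tagged literal \<open>L\<close> may follow an initial segment of a
  derivation whose set of entries is \<open>S\<close>.
\<close>

fun derivable_next :: "('a, 'l) dtheory \<Rightarrow> 'a tagged set \<Rightarrow> 'a tagged \<Rightarrow> bool" where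
  "derivable_next D S (Plus_Delta q) \<longleftrightarrow>
     q \<in> facts D \<or> (\<exists>r\<in>strict_for D q. \<forall>a\<in>ant r. Plus_Delta a \<in> S)"
| "derivable_next D S (Minus_Delta q) \<longleftrightarrow>
     q \<notin> facts D \<and> (\<forall>r\<in>strict_for D q. \<exists>a\<in>ant r. Minus_Delta a \<in> S)"
| "derivable_next D S (Plus_Partial q) \<longleftrightarrow>
     Plus_Delta q \<in> S \<or>
     ((\<exists>r\<in>supportive_for D q. \<forall>a\<in>ant r. Plus_Partial a \<in> S) \<and>
      Minus_Delta (complement q) \<in> S \<and>
      (\<forall>s\<in>rules_for D (complement q).
         (\<exists>a\<in>ant s. Minus_Partial a \<in> S) \<or>
         (\<exists>t\<in>supportive_for D q. (t, s) \<in> superior D \<and> (\<forall>a\<in>ant t. Plus_Partial a \<in> S))))"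
| "derivable_next D S (Minus_Partial q) \<longleftrightarrow>
     Minus_Delta q \<in> S \<and>
     ((\<forall>r\<in>supportive_for D q. \<exists>a\<in>ant r. Minus_Partial a \<in> S) \<or>
      Plus_Delta (complement q) \<in> S \<or>
      (\<exists>s\<in>rules_for D (complement q).
         (\<forall>a\<in>ant s. Plus_Partial a \<in> S) \<and>
         (\<forall>t\<in>supportive_for D q. (\<exists>a\<in>ant t. Minus_Partial a \<in> S) \<or> (t, s) \<notin> superior D)))"

definition derivation :: "('a, 'l) dtheory \<Rightarrow> 'a tagged list \<Rightarrow> bool" where
  "derivation D P \<longleftrightarrow> (\<forall>i<length P. derivable_next D (set (take i P)) (P ! i))"

definition derives :: "('a, 'l) dtheory \<Rightarrow> 'a tagged \<Rightarrow> bool" where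
  "derives D L \<longleftrightarrow> (\<exists>P. derivation D P \<and> L \<in> set P)"


section \<open>Dependency graph and decisiveness\<close>

definition occurring_lits :: "('a, 'l) dtheory \<Rightarrow> 'a lit set" where
  "occurring_lits D = facts D \<union> head ` rules D \<union> (\<Union>r\<in>rules D. ant r)"

definition dependency_vertices :: "('a, 'l) dtheory \<Rightarrow> 'a lit set set" where
  "dependency_vertices D = {{q, complement q} | q. q \<in> occurring_lits D}"

definition dependency_arcs :: "('a, 'l) dtheory \<Rightarrow> 'a lit set rel" where
  "dependency_arcs D =
     {(u, v) \<in> dependency_vertices D \<times> dependency_vertices D.
        \<exists>b a. u = {b, complement b} \<and> v = {a, complement a} \<and> (\<exists>r\<in>rules_for D b. a \<in> ant r)}"

definition decisive :: "('a, 'l) dtheory \<Rightarrow> bool" where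
  "decisive D \<longleftrightarrow> acyclic (dependency_arcs D)"


section \<open>Ground normal logic programs and stable models\<close>

text \<open>\<open>Clause h ps ns\<close> stands for \<open>h \<leftarrow> ps, not ns\<close>.\<close>

datatype 'g clause = Clause (chead: 'g) (pos_body: "'g list") (neg_body: "'g list")

definition herbrand_model :: "'g clause set \<Rightarrow> 'g set \<Rightarrow> bool" where
  "herbrand_model P M \<longleftrightarrow>
     (\<forall>c\<in>P. set (pos_body c) \<subseteq> M \<and> set (neg_body c) \<inter> M = {} \<longrightarrow> chead c \<in> M)"

definition reduct :: "'g clause set \<Rightarrow> 'g set \<Rightarrow> 'g clause set" where
  "reduct P M = {Clause (chead c) (pos_body c) [] | c. c \<in> P \<and> set (neg_body c) \<inter> M = {}}"

text \<open>
  For a program without negative literals (such as a reduct) the intersection of all Herbrand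
  models is the least one. It contains heads of clauses only, so a stable model never contains
  an atom outside the Herbrand base of the program.
\<close>

definition least_herbrand_model :: "'g clause set \<Rightarrow> 'g set" where
  "least_herbrand_model P = \<Inter>{M. herbrand_model P M}"

definition stable_model :: "'g clause set \<Rightarrow> 'g set \<Rightarrow> bool" where
  "stable_model P M \<longleftrightarrow> M = least_herbrand_model (reduct P M)"


section \<open>The logic program of a defeasible theory\<close>

datatype ('a, 'l) atom =
    Fact "'a lit"
  | Strict 'l "'a lit" "'a lit list"
  | Defeasible 'l "'a lit" "'a lit list"
  | Defeater 'l "'a lit" "'a lit list"
  | Sup 'l 'l
  | Supportive_Rule 'l "'a lit" "'a lit list"
  | Rule 'l "'a lit" "'a lit list"
  | Definitely "'a lit"
  | Defeasibly "'a lit"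
  | Overruled 'l "'a lit"
  | Defeated 'l "'a lit"

text \<open>
  The literals over which clause variables range: those occurring in \<open>D\<close>, closed under
  complement because the clauses apply the complement to variables.
\<close>

definition lits :: "('a, 'l) dtheory \<Rightarrow> 'a lit set" where
  "lits D = occurring_lits D \<union> complement ` occurring_lits D"

definition labels :: "('a, 'l) dtheory \<Rightarrow> 'l set" where
  "labels D = label ` rules D"

text \<open>
  Antecedents are sets, but the program represents them as list terms. The program is therefore
  relative to a function \<open>ls\<close> that writes the antecedent of each rule as a list, in any order.
\<close>

definition antecedent_listing ::
    "('a, 'l) dtheory \<Rightarrow> (('a, 'l) drule \<Rightarrow> 'a lit list) \<Rightarrow> bool" where
  "antecedent_listing D ls \<longleftrightarrow> (\<forall>r\<in>rules D. set (ls r) = ant r)"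

inductive_set program ::
    "('a, 'l) dtheory \<Rightarrow> (('a, 'l) drule \<Rightarrow> 'a lit list) \<Rightarrow> ('a, 'l) atom clause set"
  for D :: "('a, 'l) dtheory" and ls :: "('a, 'l) drule \<Rightarrow> 'a lit list" where
  supportive_strict:
    "\<lbrakk>R \<in> labels D; X \<in> lits D; B \<in> lists (lits D)\<rbrakk> \<Longrightarrow>
     Clause (Supportive_Rule R X B) [Strict R X B] [] \<in> program D ls"
| supportive_defeasible:
    "\<lbrakk>R \<in> labels D; X \<in> lits D; B \<in> lists (lits D)\<rbrakk> \<Longrightarrow>
     Clause (Supportive_Rule R X B) [Defeasible R X B] [] \<in> program D ls"
| rule_supportive:
    "\<lbrakk>R \<in> labels D; X \<in> lits D; B \<in> lists (lits D)\<rbrakk> \<Longrightarrow>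
     Clause (Rule R X B) [Supportive_Rule R X B] [] \<in> program D ls"
| rule_defeater:
    "\<lbrakk>R \<in> labels D; X \<in> lits D; B \<in> lists (lits D)\<rbrakk> \<Longrightarrow>
     Clause (Rule R X B) [Defeater R X B] [] \<in> program D ls"
| definitely_fact:
    "X \<in> lits D \<Longrightarrow>
     Clause (Definitely X) [Fact X] [] \<in> program D ls"
| definitely_strict:
    "\<lbrakk>R \<in> labels D; X \<in> lits D; Ys \<in> lists (lits D)\<rbrakk> \<Longrightarrow>
     Clause (Definitely X) (Strict R X Ys # map Definitely Ys) [] \<in> program D ls"
| defeasibly_definitely:
    "X \<in> lits D \<Longrightarrow>
     Clause (Defeasibly X) [Definitely X] [] \<in> program D ls"
| defeasibly_supportive:
    "\<lbrakk>R \<in> labels D; X \<in> lits D; Ys \<in> lists (lits D)\<rbrakk> \<Longrightarrow>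
     Clause (Defeasibly X) (Supportive_Rule R X Ys # map Defeasibly Ys)
       [Definitely (complement X), Overruled R X] \<in> program D ls"
| overruled:
    "\<lbrakk>R \<in> labels D; S \<in> labels D; X \<in> lits D; Us \<in> lists (lits D)\<rbrakk> \<Longrightarrow>
     Clause (Overruled R X) (Rule S (complement X) Us # map Defeasibly Us)
       [Defeated S (complement X)] \<in> program D ls"
| defeated:
    "\<lbrakk>S \<in> labels D; T \<in> labels D; X \<in> lits D; Vs \<in> lists (lits D)\<rbrakk> \<Longrightarrow>
     Clause (Defeated S (complement X))
       (Sup T S # Supportive_Rule T X Vs # map Defeasibly Vs) [] \<in> program D ls"
| fact:
    "p \<in> facts D \<Longrightarrow> Clause (Fact p) [] [] \<in> program D ls"
| strict:
    "\<lbrakk>r \<in> rules D; kind r = Strict_kind\<rbrakk> \<Longrightarrow>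
     Clause (Strict (label r) (head r) (ls r)) [] [] \<in> program D ls"
| defeasible:
    "\<lbrakk>r \<in> rules D; kind r = Defeasible_kind\<rbrakk> \<Longrightarrow>
     Clause (Defeasible (label r) (head r) (ls r)) [] [] \<in> program D ls"
| defeater:
    "\<lbrakk>r \<in> rules D; kind r = Defeater_kind\<rbrakk> \<Longrightarrow>
     Clause (Defeater (label r) (head r) (ls r)) [] [] \<in> program D ls"
| sup:
    "(r, s) \<in> superior D \<Longrightarrow> Clause (Sup (label r) (label s)) [] [] \<in> program D ls"

end

theory Submission
  imports Defs
begin

text \<open>
  The clauses for \<open>definitely\<close> contain no negation, so in every stable model they compute
  the closure of the facts under the strict rules, and \<open>+\<Delta>\<close> derives exactly this closure,
  whereas \<open>-\<Delta>\<close> derives only literals outside it. If \<open>D\<close> is decisive, the dependency of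
  literals on antecedents is well-founded, so that \<open>-\<Delta>\<close> derives every literal outside the closure.
  The first converse in (c) would fail for a program without stable models; hence one is built by
  solving the recursive equation for \<open>defeasibly\<close> along the dependency relation.
\<close>

section \<open>Strict provability\<close>

inductive definite :: "('a, 'l) dtheory \<Rightarrow> 'a lit \<Rightarrow> bool" for D where
  definite_fact: "q \<in> facts D \<Longrightarrow> definite D q"
| definite_strict: "\<lbrakk>r \<in> strict_for D q; \<And>a. a \<in> ant r \<Longrightarrow> definite D a\<rbrakk> \<Longrightarrow> definite D q"

text \<open>All four conditions mention \<open>S\<close> only through positive memberships: failure
  is recorded by tags of its own, never by absence from \<open>S\<close>.\<close>

lemma derivable_next_mono:
  assumes "derivable_next D S L" "S \<subseteq> T"
  shows "derivable_next D T L"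
proof -
  \<comment> \<open>These rules push the implication through the connectives down to memberships in
    \<open>S\<close>; \<open>imp_refl\<close> settles the parts that do not mention
    \<open>S\<close>.\<close>
  note mono_rules = conj_mono disj_mono ex_mono all_mono imp_mono imp_refl in_mono[OF assms(2)]
  have "derivable_next D S L \<longrightarrow> derivable_next D T L"
    by (cases L) (simp_all only: derivable_next.simps Bex_def Ball_def, (intro mono_rules)+)
  with assms(1) show ?thesis by blast
qed

lemma derivation_append:
  assumes "derivation D P" "derivation D Q"
  shows "derivation D (P @ Q)"
  unfolding derivation_def
proof (intro allI impI)
  fix i assume i: "i < length (P @ Q)"
  show "derivable_next D (set (take i (P @ Q))) ((P @ Q) ! i)"
  proof (cases "i < length P")
    case True
    then show ?thesis using assms(1) by (auto simp: derivation_def nth_append)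
  next
    case False
    then have "derivable_next D (set (take (i - length P) Q)) (Q ! (i - length P))"
      using i assms(2) by (auto simp: derivation_def)
    then have "derivable_next D (set (take i (P @ Q))) (Q ! (i - length P))"
      by (rule derivable_next_mono) auto
    then show ?thesis using False by (simp add: nth_append)
  qed
qed

lemma derivation_covers_finite:
  assumes "finite S" "\<And>L. L \<in> S \<Longrightarrow> derives D L"
  shows "\<exists>P. derivation D P \<and> S \<subseteq> set P"
  using assms
proof (induction S)
  case empty
  have "derivation D []" by (simp add: derivation_def)
  then show ?case by auto
next
  case (insert L S)
  then obtain P where "derivation D P" "S \<subseteq> set P" by auto
  moreover obtain Q where "derivation D Q" "L \<in> set Q"
    using insert.prems[of L] by (auto simp: derives_def)
  ultimately have "derivation D (P @ Q) \<and> insert L S \<subseteq> set (P @ Q)"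
    using derivation_append by auto
  then show ?case by blast
qed

text \<open>Derivations of finitely many premises concatenate into one, and the new entry goes at
  its end. Later arguments treat \<open>derives\<close> as closed under finitary rules and need no
  sequences.\<close>

lemma derives_next:
  assumes "finite S" "\<And>L. L \<in> S \<Longrightarrow> derives D L" "derivable_next D S L"
  shows "derives D L"
proof -
  obtain P where P: "derivation D P" "S \<subseteq> set P"
    using derivation_covers_finite[of S D] assms(1,2) by auto
  have "derivation D (P @ [L])"
    using P derivable_next_mono[OF assms(3) P(2)]
    by (auto simp: derivation_def nth_append less_Suc_eq)
  then show ?thesis by (auto simp: derives_def)
qed

lemma definite_derives:
  assumes fin: "\<forall>r\<in>rules D. finite (ant r)" and "definite D q"
  shows "derives D (Plus_Delta q)"
  using assms(2)
proof induction
  case (definite_fact q)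
  then show ?case by - (rule derives_next[of "{}"], auto)
next
  case (definite_strict r q)
  have "finite (ant r)"
    using definite_strict.hyps(1) fin by (auto simp: strict_for_def rules_for_def)
  with definite_strict show ?case
    by - (rule derives_next[of "Plus_Delta ` ant r"], auto)
qed

section \<open>Soundness of the strict tags\<close>

fun delta_sound :: "('a, 'l) dtheory \<Rightarrow> 'a tagged \<Rightarrow> bool" where
  "delta_sound D (Plus_Delta q) \<longleftrightarrow> definite D q"
| "delta_sound D (Minus_Delta q) \<longleftrightarrow> \<not> definite D q"
| "delta_sound D _ \<longleftrightarrow> True"

text \<open>One step of the induction along a derivation. The partial tags count as sound by
  default, since the conditions for the strict tags never consult them.\<close>

lemma derivable_next_delta_sound:
  assumes "derivable_next D S L" "\<And>K. K \<in> S \<Longrightarrow> delta_sound D K"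
  shows "delta_sound D L"
proof (cases L)
  case (Plus_Delta q)
  then consider "q \<in> facts D" | r where "r \<in> strict_for D q" "\<forall>a\<in>ant r. Plus_Delta a \<in> S"
    using assms(1) by auto
  then have "definite D q"
  proof cases
    case 1
    then show ?thesis by (rule definite_fact)
  next
    case 2
    then show ?thesis using assms(2)[of "Plus_Delta _"] by (auto intro: definite_strict[of r])
  qed
  then show ?thesis using Plus_Delta by simp
next
  case (Minus_Delta q)
  have "\<not> definite D q"
  proof
    assume "definite D q"
    \<comment> \<open>Inverting the last step of the closure is enough: the rule used there has an
      antecedent tagged \<open>Minus_Delta\<close> in \<open>S\<close>, and soundness of
      \<open>S\<close> says that this antecedent is not definite.\<close>
    then show False
    proof cases
      case definite_fact
      then show False using assms(1) Minus_Delta by simp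
    next
      case (definite_strict r)
      then obtain a where "a \<in> ant r" "Minus_Delta a \<in> S"
        using assms(1) Minus_Delta by auto
      then show False using assms(2)[of "Minus_Delta a"] definite_strict by simp
    qed
  qed
  then show ?thesis using Minus_Delta by simp
qed auto

lemma derives_delta_sound:
  assumes "derives D L"
  shows "delta_sound D L"
proof -
  obtain P i where P: "derivation D P" "i < length P" "L = P ! i"
    using assms by (auto simp: derives_def in_set_conv_nth)
  have "i < length P \<Longrightarrow> delta_sound D (P ! i)" for i
  proof (induction i rule: less_induct)
    case (less i)
    have "derivable_next D (set (take i P)) (P ! i)"
      using P(1) less.prems by (simp add: derivation_def)
    then show ?case
      by (rule derivable_next_delta_sound) (use less in \<open>auto simp: in_set_conv_nth\<close>)
  qed
  with P show ?thesis by simp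
qed

section \<open>Decisive theories\<close>

lemma complement_complement [simp]: "complement (complement q) = q"
  by (cases q) auto

text \<open>The graph arcs are reversed, so that recursion runs from antecedents to heads. The
  second alternative for the head is there because deciding \<open>b\<close> also consults the
  attacking rules for \<open>complement b\<close>.\<close>

definition depends :: "('a, 'l) dtheory \<Rightarrow> 'a lit rel" where
  "depends D = {(a, b). \<exists>r\<in>rules D. a \<in> ant r \<and> (head r = b \<or> head r = complement b)}"

text \<open>A finite acyclic relation has a well-founded converse, and sending a literal to its
  vertex \<open>{q, complement q}\<close> maps \<open>depends D\<close> into that converse.\<close>

lemma wf_depends:
  assumes D: "defeasible_theory D" and dec: "decisive D"
  shows "wf (depends D)"
proof -
  have "finite (occurring_lits D)"
    using D by (auto simp: defeasible_theory_def occurring_lits_def)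
  then have "finite (dependency_vertices D)"
    by (simp add: dependency_vertices_def setcompr_eq_image)
  moreover have "dependency_arcs D \<subseteq> dependency_vertices D \<times> dependency_vertices D"
    by (auto simp: dependency_arcs_def)
  ultimately have "finite (dependency_arcs D)"
    by (auto intro: finite_subset[OF _ finite_cartesian_product])
  then have wf: "wf ((dependency_arcs D)\<inverse>)"
    using dec by (simp add: decisive_def finite_acyclic_wf_converse)
  have "depends D \<subseteq> inv_image ((dependency_arcs D)\<inverse>) (\<lambda>q. {q, complement q})"
  proof clarify
    fix a b assume "(a, b) \<in> depends D"
    then obtain r where r: "r \<in> rules D" "a \<in> ant r" "head r = b \<or> head r = complement b"
      by (auto simp: depends_def)
    have eq: "{b, complement b} = {head r, complement (head r)}"
      using r(3) by auto
    have "a \<in> occurring_lits D" "head r \<in> occurring_lits D"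
      using r by (auto simp: occurring_lits_def)
    then have "({head r, complement (head r)}, {a, complement a}) \<in> dependency_arcs D"
      using r by (auto simp: dependency_arcs_def dependency_vertices_def rules_for_def)
    with eq show "(a, b) \<in> inv_image ((dependency_arcs D)\<inverse>) (\<lambda>q. {q, complement q})"
      by simp
  qed
  then show ?thesis by (rule wf_subset[OF wf_inv_image[OF wf]])
qed

text \<open>Every strict rule for a literal outside the closure has an antecedent outside it, which
  lies lower in \<open>depends D\<close>. In a cyclic theory this breaks down: a lone strict rule
  from \<open>p\<close> to \<open>p\<close> leaves \<open>p\<close> without either strict
  tag.\<close>

lemma not_definite_derives:
  assumes D: "defeasible_theory D" and wf: "wf (depends D)"
  shows "\<not> definite D q \<Longrightarrow> derives D (Minus_Delta q)"
  using wf
proof (induction q rule: wf_induct_rule)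
  case (less q)
  \<comment> \<open>The failing antecedents of all strict rules for \<open>q\<close> are gathered in
    one finite set, so that a single use of \<open>derives_next\<close> covers every rule.\<close>
  define A where "A = {a. \<not> definite D a \<and> (\<exists>r\<in>strict_for D q. a \<in> ant r)}"
  have "A \<subseteq> (\<Union>r\<in>rules D. ant r)"
    by (auto simp: A_def strict_for_def rules_for_def)
  then have "finite A"
    using D by (auto simp: defeasible_theory_def intro: finite_subset)
  moreover have "derives D (Minus_Delta a)" if "a \<in> A" for a
    using that
    by (intro less.IH) (auto simp: A_def strict_for_def rules_for_def depends_def)
  moreover have "q \<notin> facts D"
    using less.prems definite_fact by blast
  moreover have "\<exists>a\<in>ant r. a \<in> A" if "r \<in> strict_for D q" for r
    using less.prems definite_strict[OF that] that by (auto simp: A_def)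
  ultimately show ?case by - (rule derives_next[of "Minus_Delta ` A"], auto simp: image_iff)
qed

section \<open>Stable models\<close>

text \<open>\<open>M\<close> is the intersection of the models of its reduct. Each of them contains
  \<open>M\<close>, hence the positive body of \<open>c\<close>, and \<open>c\<close> survives in
  the reduct.\<close>

lemma stable_model_closed:
  assumes "stable_model P M" "c \<in> P" "set (pos_body c) \<subseteq> M" "set (neg_body c) \<inter> M = {}"
  shows "chead c \<in> M"
proof -
  have M: "M = \<Inter>{N. herbrand_model (reduct P M) N}"
    using assms(1) by (simp add: stable_model_def least_herbrand_model_def)
  have "chead c \<in> N" if N: "herbrand_model (reduct P M) N" for N
  proof -
    have "M \<subseteq> N" using M N by blast
    moreover have "Clause (chead c) (pos_body c) [] \<in> reduct P M"
      using assms by (auto simp: reduct_def)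
    ultimately show ?thesis
      using N assms(3) by (fastforce simp: herbrand_model_def)
  qed
  then show ?thesis using M by blast
qed

text \<open>An induction principle for stable models: negative literals are judged in
  \<open>M\<close> and positive ones in \<open>N\<close>, which is the reduct spelled out on the
  clauses of \<open>P\<close>.\<close>

lemma stable_model_least:
  assumes "stable_model P M"
    and "\<And>c. \<lbrakk>c \<in> P; set (neg_body c) \<inter> M = {}; set (pos_body c) \<subseteq> N\<rbrakk> \<Longrightarrow> chead c \<in> N"
  shows "M \<subseteq> N"
proof -
  have "herbrand_model (reduct P M) N"
    using assms(2) by (auto simp: herbrand_model_def reduct_def)
  then have "\<Inter>{N. herbrand_model (reduct P M) N} \<subseteq> N" by blast
  then show ?thesis
    using assms(1) by (simp add: stable_model_def least_herbrand_model_def)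
qed

lemma stable_modelI:
  assumes closed: "\<And>c. \<lbrakk>c \<in> P; set (neg_body c) \<inter> M = {}; set (pos_body c) \<subseteq> M\<rbrakk> \<Longrightarrow> chead c \<in> M"
    and least: "\<And>N. (\<And>c. \<lbrakk>c \<in> P; set (neg_body c) \<inter> M = {}; set (pos_body c) \<subseteq> N\<rbrakk>
      \<Longrightarrow> chead c \<in> N) \<Longrightarrow> M \<subseteq> N"
  shows "stable_model P M"
proof -
  have "herbrand_model (reduct P M) M"
    using closed by (auto simp: herbrand_model_def reduct_def)
  moreover have "M \<subseteq> N" if "herbrand_model (reduct P M) N" for N
  proof (rule least)
    fix c assume "c \<in> P" "set (neg_body c) \<inter> M = {}" "set (pos_body c) \<subseteq> N"
    moreover from this have "Clause (chead c) (pos_body c) [] \<in> reduct P M"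
      by (auto simp: reduct_def)
    ultimately show "chead c \<in> N"
      using that by (fastforce simp: herbrand_model_def)
  qed
  ultimately show ?thesis
    unfolding stable_model_def least_herbrand_model_def by blast
qed

section \<open>The definite part of the program\<close>

lemma rule_in_lits:
  assumes "r \<in> rules D"
  shows "label r \<in> labels D" "head r \<in> lits D" "ant r \<subseteq> lits D"
  using assms by (auto simp: labels_def lits_def occurring_lits_def)

lemma fact_in_lits: "q \<in> facts D \<Longrightarrow> q \<in> lits D"
  by (auto simp: lits_def occurring_lits_def)

lemma antecedent_listing_in_lits:
  assumes "antecedent_listing D ls" "r \<in> rules D"
  shows "set (ls r) = ant r" "ls r \<in> lists (lits D)"
  using assms rule_in_lits(3)[of r D] by (auto simp: antecedent_listing_def in_lists_conv_set)

text \<open>Asking closure of \<open>N\<close> only under negation-free clauses makes the lemma fit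
  stable models as well as the arbitrary sets \<open>N\<close> in the minimality proof for the
  constructed model.\<close>

lemma definite_closed:
  assumes ls: "antecedent_listing D ls" and "definite D q"
    and closed: "\<And>c. \<lbrakk>c \<in> program D ls; neg_body c = []; set (pos_body c) \<subseteq> N\<rbrakk> \<Longrightarrow> chead c \<in> N"
  shows "Definitely q \<in> N"
  using assms(2)
proof induction
  case (definite_fact q)
  have "Fact q \<in> N"
    using closed[OF program.fact[OF definite_fact]] by simp
  then show ?case
    using closed[OF program.definitely_fact[OF fact_in_lits[OF definite_fact]]] by simp
next
  case (definite_strict r q)
  then have r: "r \<in> rules D" "kind r = Strict_kind" "head r = q"
    by (auto simp: strict_for_def rules_for_def)
  have "Strict (label r) q (ls r) \<in> N"
    using closed[OF program.strict[OF r(1,2)]] r(3) by simp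
  then show ?case
    using closed[OF program.definitely_strict[of "label r" D q "ls r" ls]]
      definite_strict.IH rule_in_lits[OF r(1)] antecedent_listing_in_lits[OF ls r(1)] r(3)
    by auto
qed

lemma stable_model_definitely_iff:
  assumes ls: "antecedent_listing D ls" and M: "stable_model (program D ls) M"
  shows "Definitely q \<in> M \<longleftrightarrow> definite D q"
proof
  assume "definite D q"
  then show "Definitely q \<in> M"
    by (rule definite_closed[OF ls]) (use stable_model_closed[OF M] in auto)
next
  \<comment> \<open>\<open>N\<close> restricts only the atoms on which \<open>Definitely\<close>
    depends and admits all others, so clauses with other heads are trivially respected.\<close>
  define N :: "('a, 'b) atom set" where
    "N = {x. (\<forall>q. x = Definitely q \<longrightarrow> definite D q) \<and> (\<forall>q. x = Fact q \<longrightarrow> q \<in> facts D) \<and>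
             (\<forall>l q B. x = Strict l q B \<longrightarrow> (\<exists>r\<in>strict_for D q. set B = ant r))}"
  have "M \<subseteq> N"
  proof (rule stable_model_least[OF M])
    fix c assume "c \<in> program D ls" "set (pos_body c) \<subseteq> N"
    then show "chead c \<in> N"
    proof cases
      case (definitely_strict R X Ys)
      then obtain r where "r \<in> strict_for D X" "set Ys = ant r"
        using \<open>set (pos_body c) \<subseteq> N\<close> by (auto simp: N_def)
      moreover have "definite D a" if "a \<in> set Ys" for a
        using that definitely_strict \<open>set (pos_body c) \<subseteq> N\<close> by (auto simp: N_def)
      ultimately show ?thesis
        using definitely_strict by (auto simp: N_def intro: definite.definite_strict)
    next
      case (strict r)
      then show ?thesis
        using antecedent_listing_in_lits[OF ls]
        by (auto simp: N_def strict_for_def rules_for_def)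
    qed (auto simp: N_def intro: definite_fact)
  qed
  then show "Definitely q \<in> M \<Longrightarrow> definite D q"
    by (auto simp: N_def)
qed

section \<open>A stable model of a decisive theory\<close>

text \<open>The clauses for \<open>defeasibly\<close> with \<open>overruled\<close> and
  \<open>defeated\<close> unfolded into them: one recursive equation replaces three predicates that
  are mutually dependent through negation.\<close>

definition defeasible_step :: "('a, 'l) dtheory \<Rightarrow> ('a lit \<Rightarrow> bool) \<Rightarrow> 'a lit \<Rightarrow> bool" where
  "defeasible_step D E q \<longleftrightarrow>
     definite D q \<or>
     \<not> definite D (complement q) \<and>
     (\<exists>r\<in>supportive_for D q. \<forall>a\<in>ant r. E a) \<and>
     (\<forall>s\<in>rules_for D (complement q). (\<forall>a\<in>ant s. E a) \<longrightarrow>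
        (\<exists>t\<in>supportive_for D q. (t, s) \<in> superior D \<and> (\<forall>a\<in>ant t. E a)))"

text \<open>The operator is not monotone in \<open>E\<close>, as attackers use it negatively. Its
  value at \<open>q\<close> depends only on antecedents of rules for \<open>q\<close> and
  \<open>complement q\<close>, so well-founded recursion supplies the solution.\<close>

lemma defeasible_step_fixpoint:
  assumes "wf (depends D)"
  shows "\<exists>E. \<forall>q. E q \<longleftrightarrow> defeasible_step D E q"
proof -
  have "adm_wf (depends D) (defeasible_step D)"
    unfolding adm_wf_def
  proof (intro allI impI)
    fix E E' :: "'a lit \<Rightarrow> bool" and q
    assume eq: "\<forall>a. (a, q) \<in> depends D \<longrightarrow> E a = E' a"
    have supp: "(\<forall>a\<in>ant r. E a) \<longleftrightarrow> (\<forall>a\<in>ant r. E' a)" if "r \<in> supportive_for D q" for r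
      using that eq by (auto simp: depends_def supportive_for_def rules_for_def)
    have att: "(\<forall>a\<in>ant s. E a) \<longleftrightarrow> (\<forall>a\<in>ant s. E' a)" if "s \<in> rules_for D (complement q)" for s
      using that eq by (auto simp: depends_def rules_for_def)
    show "defeasible_step D E q = defeasible_step D E' q"
      unfolding defeasible_step_def using supp att by (simp cong: bex_cong ball_cong conj_cong)
  qed
  then have "wfrec (depends D) (defeasible_step D)
      = defeasible_step D (wfrec (depends D) (defeasible_step D))"
    by (rule wfrec_fixpoint[OF assms])
  then show ?thesis by metis
qed

text \<open>The candidate stable model determined by \<open>E\<close>. No body atom of the clause
  for \<open>Overruled\<close> fixes its rule label, so the ranges are imposed explicitly:
  minimality excludes atoms outside the Herbrand base.\<close>

fun holds :: "('a, 'l) dtheory \<Rightarrow> (('a, 'l) drule \<Rightarrow> 'a lit list) \<Rightarrow> ('a lit \<Rightarrow> bool)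
    \<Rightarrow> ('a, 'l) atom \<Rightarrow> bool" where
  "holds D ls E (Fact q) \<longleftrightarrow> q \<in> facts D"
| "holds D ls E (Strict l q B) \<longleftrightarrow>
     (\<exists>r\<in>rules_for D q. kind r = Strict_kind \<and> label r = l \<and> ls r = B)"
| "holds D ls E (Defeasible l q B) \<longleftrightarrow>
     (\<exists>r\<in>rules_for D q. kind r = Defeasible_kind \<and> label r = l \<and> ls r = B)"
| "holds D ls E (Defeater l q B) \<longleftrightarrow>
     (\<exists>r\<in>rules_for D q. kind r = Defeater_kind \<and> label r = l \<and> ls r = B)"
| "holds D ls E (Sup l m) \<longleftrightarrow> (\<exists>r s. (r, s) \<in> superior D \<and> label r = l \<and> label s = m)"
| "holds D ls E (Supportive_Rule l q B) \<longleftrightarrow>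
     (\<exists>r\<in>supportive_for D q. label r = l \<and> ls r = B)"
| "holds D ls E (Rule l q B) \<longleftrightarrow> (\<exists>r\<in>rules_for D q. label r = l \<and> ls r = B)"
| "holds D ls E (Definitely q) \<longleftrightarrow> definite D q"
| "holds D ls E (Defeasibly q) \<longleftrightarrow> E q"
| "holds D ls E (Overruled l q) \<longleftrightarrow>
     l \<in> labels D \<and> q \<in> lits D \<and>
     (\<exists>s\<in>rules_for D (complement q). (\<forall>a\<in>ant s. E a) \<and>
        \<not> (\<exists>t\<in>supportive_for D q. (t, s) \<in> superior D \<and> (\<forall>a\<in>ant t. E a)))"
| "holds D ls E (Defeated l q) \<longleftrightarrow>
     (\<exists>s t. t \<in> supportive_for D (complement q) \<and> label s = l \<and> (t, s) \<in> superior D \<and>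
        (\<forall>a\<in>ant t. E a))"

section \<open>Stability of the candidate model\<close>

context
  fixes D :: "('a, 'l) dtheory" and ls E
  assumes D: "defeasible_theory D"
    and ls: "antecedent_listing D ls"
    and E: "\<And>q. E q \<longleftrightarrow> defeasible_step D E q"
begin

lemma label_inject:
  assumes "label r = label s" "r \<in> rules D" "s \<in> rules D"
  shows "r = s"
  using assms D by (auto simp: defeasible_theory_def dest: inj_onD)

lemma superior_rules:
  assumes "(t, s) \<in> superior D"
  shows "t \<in> rules D" "s \<in> rules D"
  using assms D by (auto simp: defeasible_theory_def)

lemma supportive_ruleD: "r \<in> supportive_for D q \<Longrightarrow> r \<in> rules D \<and> head r = q"
  by (auto simp: supportive_for_def rules_for_def)

text \<open>\<open>Defeated\<close> speaks of a label only; unique labels turn it into a statement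
  about the rule \<open>s\<close> itself.\<close>

lemma holds_defeated_label:
  assumes "s \<in> rules D"
  shows "holds D ls E (Defeated (label s) (complement q)) \<longleftrightarrow>
    (\<exists>t\<in>supportive_for D q. (t, s) \<in> superior D \<and> (\<forall>a\<in>ant t. E a))"
proof -
  have "s' = s" if "(t, s') \<in> superior D" "label s' = label s" for t s'
    using label_inject[OF that(2) superior_rules(2)[OF that(1)] assms] .
  then show ?thesis by (simp, blast)
qed

text \<open>The equation for \<open>E\<close>, read from right to left, handles the two clauses with
  head \<open>Defeasibly\<close>; the other clauses follow from the shape of
  \<open>holds\<close>.\<close>

lemma holds_closed:
  assumes "c \<in> program D ls"
    and "set (neg_body c) \<inter> Collect (holds D ls E) = {}"
    and pos: "set (pos_body c) \<subseteq> Collect (holds D ls E)"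
  shows "holds D ls E (chead c)"
  using assms(1)
proof cases
  case (definitely_strict R X Ys)
  then obtain r where "r \<in> strict_for D X" "ls r = Ys"
    using pos by (auto simp: strict_for_def)
  moreover from this have "set Ys = ant r"
    using antecedent_listing_in_lits[OF ls] by (auto simp: strict_for_def rules_for_def)
  moreover have "definite D a" if "a \<in> set Ys" for a
    using that definitely_strict pos by auto
  ultimately show ?thesis
    using definitely_strict by (auto intro: definite.definite_strict)
next
  case (defeasibly_definitely X)
  then show ?thesis using pos E[of X] by (simp add: defeasible_step_def)
next
  case (defeasibly_supportive R X Ys)
  then obtain r where r: "r \<in> supportive_for D X" "label r = R" "ls r = Ys"
    using pos by auto
  then have "set Ys = ant r"
    using antecedent_listing_in_lits[OF ls] supportive_ruleD by auto
  then have "\<forall>a\<in>ant r. E a"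
    using pos defeasibly_supportive by auto
  moreover have "\<not> definite D (complement X)" "\<not> holds D ls E (Overruled R X)"
    using assms(2) defeasibly_supportive by auto
  \<comment> \<open>Since \<open>R\<close> and \<open>X\<close> lie in their ranges, the failure of
    \<open>Overruled R X\<close> says exactly that every applicable attacker is defeated.\<close>
  ultimately have "defeasible_step D E X"
    using r(1) defeasibly_supportive unfolding defeasible_step_def by auto
  then show ?thesis using E defeasibly_supportive by simp
next
  case (overruled R S X Us)
  then obtain s where s: "s \<in> rules_for D (complement X)" "label s = S" "ls s = Us"
    using pos by auto
  then have s': "s \<in> rules D" by (simp add: rules_for_def)
  then have "set Us = ant s"
    using antecedent_listing_in_lits[OF ls] s(3) by auto
  then have "\<forall>a\<in>ant s. E a"
    using pos overruled by auto
  moreover have "\<not> holds D ls E (Defeated (label s) (complement X))"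
    using assms(2) overruled s(2) by auto
  ultimately have "holds D ls E (Overruled R X)"
    using overruled s unfolding holds_defeated_label[OF s'] by auto
  then show ?thesis using overruled by simp
next
  case (defeated S T X Vs)
  then obtain t where t: "t \<in> supportive_for D X" "label t = T" "ls t = Vs"
    using pos by auto
  obtain t' s where ts: "(t', s) \<in> superior D" "label t' = T" "label s = S"
    using pos defeated by auto
  \<comment> \<open>\<open>Sup\<close> and \<open>Supportive_Rule\<close> share only the label
    \<open>T\<close>, so unique labels must identify the rules behind them.\<close>
  have t': "t' = t"
    using label_inject[of t' t] superior_rules(1)[OF ts(1)] ts(2) t supportive_ruleD by auto
  have "set Vs = ant t"
    using antecedent_listing_in_lits[OF ls] t supportive_ruleD by auto
  then have "\<forall>a\<in>ant t. E a"
    using pos defeated by auto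
  then have "holds D ls E (Defeated S (complement X))"
    using t ts t' by auto
  then show ?thesis using defeated by simp
qed (use pos in \<open>auto simp: supportive_for_def rules_for_def intro: definite_fact\<close>)

text \<open>Atoms enter \<open>N\<close> in layers: program facts, rule atoms,
  \<open>Definitely\<close>, then \<open>Defeasibly\<close> by induction along
  \<open>depends D\<close>, and last \<open>Overruled\<close> and \<open>Defeated\<close>. Negative
  literals are judged in the candidate and not in \<open>N\<close>, so this order is not
  circular.\<close>

lemma holds_least:
  assumes wf: "wf (depends D)"
    and closed: "\<And>c. \<lbrakk>c \<in> program D ls; set (neg_body c) \<inter> Collect (holds D ls E) = {};
      set (pos_body c) \<subseteq> N\<rbrakk> \<Longrightarrow> chead c \<in> N"
    and x: "holds D ls E x"
  shows "x \<in> N"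
proof -
  have fact: "Fact q \<in> N" if "q \<in> facts D" for q
    using closed[OF program.fact[OF that]] by simp
  have strict: "Strict (label r) (head r) (ls r) \<in> N"
    if "r \<in> rules D" "kind r = Strict_kind" for r
    using closed[OF program.strict[OF that]] by simp
  have defeasible: "Defeasible (label r) (head r) (ls r) \<in> N"
    if "r \<in> rules D" "kind r = Defeasible_kind" for r
    using closed[OF program.defeasible[OF that]] by simp
  have defeater: "Defeater (label r) (head r) (ls r) \<in> N"
    if "r \<in> rules D" "kind r = Defeater_kind" for r
    using closed[OF program.defeater[OF that]] by simp
  have sup: "Sup (label r) (label s) \<in> N" if "(r, s) \<in> superior D" for r s
    using closed[OF program.sup[OF that]] by simp
  \<comment> \<open>The range conditions for instantiating a clause at the label, head and
    antecedent list of a rule.\<close>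
  note lits = rule_in_lits(1,2) antecedent_listing_in_lits(2)[OF ls]
  have supportive: "Supportive_Rule (label r) q (ls r) \<in> N" if "r \<in> supportive_for D q" for r q
  proof -
    have r: "r \<in> rules D" "head r = q" using supportive_ruleD[OF that] by auto
    have "kind r = Strict_kind \<or> kind r = Defeasible_kind"
      using that by (simp add: supportive_for_def)
    then show ?thesis
      using closed[OF program.supportive_strict[OF lits[OF r(1)]]] strict[OF r(1)]
        closed[OF program.supportive_defeasible[OF lits[OF r(1)]]] defeasible[OF r(1)] r(2)
      by auto
  qed
  have rule: "Rule (label r) q (ls r) \<in> N" if "r \<in> rules_for D q" for r q
  proof -
    have r: "r \<in> rules D" "head r = q" using that by (auto simp: rules_for_def)
    show ?thesis
    proof (cases "kind r = Defeater_kind")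
      case True
      then show ?thesis
        using closed[OF program.rule_defeater[OF lits[OF r(1)]]] defeater[OF r(1)] r(2)
        by auto
    next
      case False
      then have "r \<in> supportive_for D q"
        using that by (cases "kind r") (auto simp: supportive_for_def)
      from supportive[OF this] show ?thesis
        using closed[OF program.rule_supportive[OF lits[OF r(1)]]] r(2) by auto
    qed
  qed
  have definitely: "Definitely q \<in> N" if "definite D q" for q
    using that by (rule definite_closed[OF ls]) (use closed in auto)
  have definite_lits: "q \<in> lits D" if "definite D q" for q
    using that
    by cases (auto simp: fact_in_lits strict_for_def rules_for_def intro: rule_in_lits)
  have defeasibly: "E q \<Longrightarrow> Defeasibly q \<in> N" for q
    using wf
  proof (induction q rule: wf_induct_rule)
    case (less q)
    show ?case
    proof (cases "definite D q")
      case True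
      then show ?thesis
        using closed[OF program.defeasibly_definitely[OF definite_lits[OF True]]]
          definitely by auto
    next
      case False
      with less.prems E[of q] obtain r where r: "r \<in> supportive_for D q" "\<forall>a\<in>ant r. E a"
        and not_strict: "\<not> definite D (complement q)"
        and attackers_defeated: "\<forall>s\<in>rules_for D (complement q). (\<forall>a\<in>ant s. E a) \<longrightarrow>
          (\<exists>t\<in>supportive_for D q. (t, s) \<in> superior D \<and> (\<forall>a\<in>ant t. E a))"
        unfolding defeasible_step_def by blast
      have not_overruled: "\<not> holds D ls E (Overruled (label r) q)"
        using attackers_defeated by auto
      have r': "r \<in> rules D" "head r = q" using supportive_ruleD[OF r(1)] by auto
      have "(a, q) \<in> depends D" if "a \<in> ant r" for a
        using that r' by (auto simp: depends_def)
      then have "Defeasibly a \<in> N" if "a \<in> ant r" for a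
        using that r(2) less.IH by auto
      \<comment> \<open>The equation for \<open>Overruled\<close> is kept folded so that
        \<open>not_overruled\<close> matches the negative literal of the clause.\<close>
      then show ?thesis
        using closed[OF program.defeasibly_supportive[OF lits[OF r'(1)]]]
          supportive[OF r(1)] not_strict not_overruled r'
          antecedent_listing_in_lits(1)[OF ls r'(1)]
        by (auto simp del: holds.simps(10))
    qed
  qed
  show ?thesis
  proof (cases x)
    case (Overruled l q)
    then obtain s where s: "s \<in> rules_for D (complement q)" "\<forall>a\<in>ant s. E a"
      and undefeated: "\<not> (\<exists>t\<in>supportive_for D q. (t, s) \<in> superior D \<and> (\<forall>a\<in>ant t. E a))"
      and lq: "l \<in> labels D" "q \<in> lits D"
      using x by auto
    have s': "s \<in> rules D" using s(1) by (simp add: rules_for_def)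
    have "\<not> holds D ls E (Defeated (label s) (complement q))"
      using undefeated holds_defeated_label[OF s'] by blast
    then show ?thesis
      using closed[OF program.overruled[OF lq(1) lits(1)[OF s'] lq(2) lits(3)[OF s']]]
        rule[OF s(1)] s(2) defeasibly Overruled antecedent_listing_in_lits(1)[OF ls s']
      by (auto simp del: holds.simps(11))
  next
    case (Defeated l q)
    then obtain s t where t: "t \<in> supportive_for D (complement q)" "\<forall>a\<in>ant t. E a"
      and s: "label s = l" "(t, s) \<in> superior D"
      using x by auto
    have t': "t \<in> rules D" "head t = complement q" using supportive_ruleD[OF t(1)] by auto
    have s': "s \<in> rules D" using superior_rules s(2) by auto
    show ?thesis
      using closed[OF program.defeated[OF lits(1)[OF s'] lits[OF t'(1)]]]
        supportive[OF t(1)] sup[OF s(2)] t(2) t' s defeasibly Defeated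
        antecedent_listing_in_lits(1)[OF ls t'(1)]
      by auto
  qed (use x fact strict defeasible defeater sup supportive rule definitely defeasibly
        in \<open>auto simp: rules_for_def\<close>)
qed

lemma stable_model_holds:
  assumes "wf (depends D)"
  shows "stable_model (program D ls) (Collect (holds D ls E))"
proof (rule stable_modelI)
  fix N assume "\<And>c. \<lbrakk>c \<in> program D ls; set (neg_body c) \<inter> Collect (holds D ls E) = {};
    set (pos_body c) \<subseteq> N\<rbrakk> \<Longrightarrow> chead c \<in> N"
  from holds_least[OF assms this] show "Collect (holds D ls E) \<subseteq> N" by blast
qed (use holds_closed in blast)

end

theorem theorem5p2:
  fixes D :: "('a, 'l) dtheory"
    and ls :: "('a, 'l) drule \<Rightarrow> 'a lit list"
    and p :: "'a lit"
  assumes "defeasible_theory D"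
    and "antecedent_listing D ls"
  shows "(derives D (Plus_Delta p) \<longrightarrow>
            (\<forall>M. stable_model (program D ls) M \<longrightarrow> Definitely p \<in> M)) \<and>
         (derives D (Minus_Delta p) \<longrightarrow>
            (\<forall>M. stable_model (program D ls) M \<longrightarrow> Definitely p \<notin> M)) \<and>
         (decisive D \<longrightarrow>
            ((\<forall>M. stable_model (program D ls) M \<longrightarrow> Definitely p \<in> M) \<longrightarrow>
               derives D (Plus_Delta p)) \<and>
            ((\<forall>M. stable_model (program D ls) M \<longrightarrow> Definitely p \<notin> M) \<longrightarrow>
               derives D (Minus_Delta p)))"
proof (intro conjI impI allI)
  fix M assume "derives D (Plus_Delta p)" and M: "stable_model (program D ls) M"
  then have "definite D p" using derives_delta_sound by fastforce
  then show "Definitely p \<in> M" using stable_model_definitely_iff[OF assms(2) M] by simp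
next
  fix M assume "derives D (Minus_Delta p)" and M: "stable_model (program D ls) M"
  then have "\<not> definite D p" using derives_delta_sound by fastforce
  then show "Definitely p \<notin> M" using stable_model_definitely_iff[OF assms(2) M] by simp
next
  assume "decisive D"
  then have wf: "wf (depends D)" by (rule wf_depends[OF assms(1)])
  then obtain E where "\<And>q. E q \<longleftrightarrow> defeasible_step D E q"
    using defeasible_step_fixpoint by metis
  then have M: "stable_model (program D ls) (Collect (holds D ls E))"
    by (rule stable_model_holds[OF assms _ wf])
  \<comment> \<open>At the constructed model, either hypothesis about all stable models decides
    \<open>definite D p\<close>.\<close>
  note iff = stable_model_definitely_iff[OF assms(2) M, of p]
  {
    assume "\<forall>M. stable_model (program D ls) M \<longrightarrow> Definitely p \<in> M"
    then have "definite D p" using iff M by blast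
    moreover have "\<forall>r\<in>rules D. finite (ant r)"
      using assms(1) by (simp add: defeasible_theory_def)
    ultimately show "derives D (Plus_Delta p)" using definite_derives by blast
  next
    assume "\<forall>M. stable_model (program D ls) M \<longrightarrow> Definitely p \<notin> M"
    then have "\<not> definite D p" using iff M by blast
    then show "derives D (Minus_Delta p)" by (rule not_definite_derives[OF assms(1) wf])
  }
qed

end
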